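(* Let $\mathcal{H}=\bigcup_{i=1}^n\prod_{j=1}^kP_{ij}\subset\mathbb{R}^{n_1}\times\cdots\times\mathbb{R}^{n_k}$ be an axis-aligned region, where each $P_{ij}\subset\mathbb{R}^{n_j}$ is a polytope. The Markov chain construction algorithm described in the context, applied to $\mathcal{H}$, terminates in finitely many iterations and yields an absorbing Markov chain $(\mathcal{X},T)$ for which the corner points $\operatorname{corner}(\mathcal{H})$ serve as the absorbing states. Moreover, with $T^*:=\lim_{t\to\infty}T^t$ the limiting transition matrix, for any multilinear function $M:\mathcal{H}\to\mathbb{R}$ and every $x\in\mathcal{X}$, $$\bigl(x,M(x)\bigr)=\sum_{v\in\operatorname{corner}(\mathcal{H})}T^*(x,v)\cdot\bigl(v,M(v)\bigr).$$ Further, let $x\in P_i:=\prod_{j=1}^kP_{ij}\subseteq\mathcal{H}$, and for each $j\in[k]$ let $x_j=\sum_{v'_j\in\operatorname{vert}(P_{ij})}\lambda(v'_j)\,v'_j$ be a representation of $x_j$ as a convex combination of the vertices of $P_{ij}$. Then $$\bigl(x,M(x)\bigr)=\sum_{v'\in\operatorname{vert}(P_i)}\ \sum_{v\in\operatorname{corner}(\mathcal{H})}\Bigl(\prod_{j=1}^k\lambda(v'_j)\Bigr)T^*(v',v)\cdot\bigl(v,M(v)\bigr).$$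
   Context: Notation: $[k]=\{1,\ldots,k\}$; $\operatorname{vert}(S)$ is the set of extreme points of $S$. A subset of $\mathbb{R}^{n_1}\times\cdots\times\mathbb{R}^{n_k}$ is axis-aligned if it can be written as a finite union $\bigcup_{i=1}^n\prod_{j=1}^kP_{ij}$ with each $P_{ij}$ a polytope in $\mathbb{R}^{n_j}$; such a representation is fixed, and $\operatorname{disc}(\mathcal{H}):=\bigcup_{i=1}^n\prod_{j=1}^k\operatorname{vert}(P_{ij})$. Points are written in blocks $x=(x_1,\ldots,x_k)$ with $x_j\in\mathbb{R}^{n_j}$. A point $v=(v_1,\ldots,v_k)$ is a corner point of $\mathcal{H}$ if for each $j\in[k]$ the vector $v_j$ is an extreme point of $\operatorname{conv}(S_j(v))$, where $S_j(v):=\{x_j : x\in\mathcal{H},\ x_{j'}=v_{j'}\text{ for all } j'\in[k]\setminus\{j\}\}$. The set of corner points is $\operatorname{corner}(\mathcal{H})$. A multilinear function is one that is affine in each block $x_j\in\mathbb{R}^{n_j}$ when the other blocks are fixed ($M:\mathcal{H}\to\mathbb{R}$ is the restriction of such a function on $\mathbb{R}^{n_1}\times\cdots\times\mathbb{R}^{n_k}$). Algorithm. Initialize the state space $\mathcal{X}\gets\operatorname{disc}(\mathcal{H})$, all transition probabilities to $0$, and a stack $\mathcal{U}\gets\mathcal{X}$ of unprocessed points. While $\mathcal{U}\ne\emptyset$: pop $v$ from $\mathcal{U}$. If $v_j\in\operatorname{vert}(\operatorname{conv}(S_j(v)))$ for all $j\in[k]$, set $T(v,v)=1$. Otherwise let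 $j^*$ be the smallest $j$ with $v_j\notin\operatorname{vert}(\operatorname{conv}(S_j(v)))$; choose any representation of $v_{j^*}$ as a convex combination of the points of $\operatorname{vert}(\operatorname{conv}(S_{j^*}(v)))$, and identify each such vertex with the point $u$ obtained from $v$ by replacing the block $v_{j^*}$ by that vertex, so that $v=\sum_u\lambda_uu$ with $\lambda_u\ge 0$, $\sum_u\lambda_u=1$. For each $u$ with $\lambda_u>0$: if $u\notin\mathcal{X}\cup\mathcal{U}$, add $u$ to both $\mathcal{X}$ and $\mathcal{U}$; set $T(v,u)=\lambda_u$. Return $(\mathcal{X},T)$. A state $x$ of a finite Markov chain is absorbing if $T(x,x)=1$; the chain is absorbing if it has at least one absorbing state and from every state some absorbing state can be reached (possibly in several steps). *)

theory Defs
  imports "HOL-Analysis.Analysis"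
begin

text \<open>
  The space \<open>\<real>\<^sup>n\<^sub>1 \<times> \<dots> \<times> \<real>\<^sup>n\<^sub>k\<close> is \<open>real ^ 'n\<close> together with a map \<open>blk\<close> that sends every
  coordinate to the number in \<open>{1..k}\<close> of its block; so \<open>n\<^sub>j\<close> is the number of coordinates \<open>c\<close>
  with \<open>blk c = j\<close>.  The factor \<open>\<real>\<^sup>n\<^sub>j\<close> is identified with the coordinate subspace
  \<open>block_space blk j\<close>, and the block \<open>x\<^sub>j\<close> of a point \<open>x\<close> with its projection \<open>block blk j x\<close>
  to that subspace.
\<close>

definition block_space :: "('n::finite \<Rightarrow> nat) \<Rightarrow> nat \<Rightarrow> (real ^ 'n) set" where
  "block_space blk j = {y. \<forall>c. blk c \<noteq> j \<longrightarrow> y $ c = 0}"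

definition block :: "('n::finite \<Rightarrow> nat) \<Rightarrow> nat \<Rightarrow> real ^ 'n \<Rightarrow> real ^ 'n" where
  "block blk j x = (\<chi> c. if blk c = j then x $ c else 0)"

definition replace_block ::
    "('n::finite \<Rightarrow> nat) \<Rightarrow> nat \<Rightarrow> real ^ 'n \<Rightarrow> real ^ 'n \<Rightarrow> real ^ 'n" where
  "replace_block blk j x y = (\<chi> c. if blk c = j then y $ c else x $ c)"

definition block_prod ::
    "('n::finite \<Rightarrow> nat) \<Rightarrow> nat \<Rightarrow> (nat \<Rightarrow> (real ^ 'n) set) \<Rightarrow> (real ^ 'n) set" where
  "block_prod blk k Q = {x. \<forall>j\<in>{1..k}. block blk j x \<in> Q j}"

definition vert :: "'a::real_vector set \<Rightarrow> 'a set" where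
  "vert S = {v. v extreme_point_of S}"

definition region ::
    "('n::finite \<Rightarrow> nat) \<Rightarrow> nat \<Rightarrow> nat \<Rightarrow> (nat \<Rightarrow> nat \<Rightarrow> (real ^ 'n) set) \<Rightarrow> (real ^ 'n) set" where
  "region blk k n P = (\<Union>i\<in>{1..n}. block_prod blk k (P i))"

definition disc ::
    "('n::finite \<Rightarrow> nat) \<Rightarrow> nat \<Rightarrow> nat \<Rightarrow> (nat \<Rightarrow> nat \<Rightarrow> (real ^ 'n) set) \<Rightarrow> (real ^ 'n) set" where
  "disc blk k n P = (\<Union>i\<in>{1..n}. block_prod blk k (\<lambda>j. vert (P i j)))"

definition slice ::
    "('n::finite \<Rightarrow> nat) \<Rightarrow> nat \<Rightarrow> (real ^ 'n) set \<Rightarrow> real ^ 'n \<Rightarrow> nat \<Rightarrow> (real ^ 'n) set" where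
  "slice blk k H v j =
     {block blk j x | x. x \<in> H \<and> (\<forall>j'\<in>{1..k} - {j}. block blk j' x = block blk j' v)}"

definition extreme_block ::
    "('n::finite \<Rightarrow> nat) \<Rightarrow> nat \<Rightarrow> (real ^ 'n) set \<Rightarrow> real ^ 'n \<Rightarrow> nat \<Rightarrow> bool" where
  "extreme_block blk k H v j \<longleftrightarrow> block blk j v \<in> vert (convex hull (slice blk k H v j))"

definition corner ::
    "('n::finite \<Rightarrow> nat) \<Rightarrow> nat \<Rightarrow> (real ^ 'n) set \<Rightarrow> (real ^ 'n) set" where
  "corner blk k H = {v. \<forall>j\<in>{1..k}. extreme_block blk k H v j}"

definition multilinear ::
    "('n::finite \<Rightarrow> nat) \<Rightarrow> nat \<Rightarrow> (real ^ 'n \<Rightarrow> real) \<Rightarrow> bool" where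
  "multilinear blk k M \<longleftrightarrow>
     (\<forall>j\<in>{1..k}. \<forall>x. \<exists>f c. linear f \<and>
        (\<forall>y\<in>block_space blk j. M (replace_block blk j x y) = f y + c))"

definition multilinear_on ::
    "('n::finite \<Rightarrow> nat) \<Rightarrow> nat \<Rightarrow> (real ^ 'n) set \<Rightarrow> (real ^ 'n \<Rightarrow> real) \<Rightarrow> bool" where
  "multilinear_on blk k H M \<longleftrightarrow> (\<exists>M'. multilinear blk k M' \<and> (\<forall>x\<in>H. M x = M' x))"


text \<open>
  The algorithm is nondeterministic (order of the stack, choice of the convex representation), so
  one iteration of its loop is a relation.  A state \<open>(X, U, T)\<close> holds the state space, the stack of
  unprocessed points with its top at the head of the list, and the transition probabilities.
\<close>

type_synonym 'n mc_state =
  "(real ^ 'n) set \<times> (real ^ 'n) list \<times> (real ^ 'n \<Rightarrow> real ^ 'n \<Rightarrow> real)"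

definition mc_init ::
    "('n::finite \<Rightarrow> nat) \<Rightarrow> nat \<Rightarrow> nat \<Rightarrow> (nat \<Rightarrow> nat \<Rightarrow> (real ^ 'n) set) \<Rightarrow> 'n mc_state \<Rightarrow> bool" where
  "mc_init blk k n P s \<longleftrightarrow>
     (\<exists>U. distinct U \<and> set U = disc blk k n P \<and> s = (disc blk k n P, U, \<lambda>_ _. 0))"

text \<open>
  In rule \<open>move\<close>, \<open>\<mu>\<close> gives the weights on the vertices \<open>w\<close> of block \<open>j\<close>, and \<open>N\<close> is the set of the
  points \<open>u\<close> of positive weight \<open>\<lambda>\<^sub>u = \<mu> (block blk j u)\<close>.
\<close>

inductive mc_step ::
    "('n::finite \<Rightarrow> nat) \<Rightarrow> nat \<Rightarrow> (real ^ 'n) set \<Rightarrow> 'n mc_state \<Rightarrow> 'n mc_state \<Rightarrow> bool"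
  for blk k H where
  stay: "\<forall>j\<in>{1..k}. extreme_block blk k H v j \<Longrightarrow>
     mc_step blk k H (X, v # U, T) (X, U, \<lambda>a b. if a = v \<and> b = v then 1 else T a b)"
| move: "\<lbrakk> j \<in> {1..k}; \<not> extreme_block blk k H v j; \<forall>j'\<in>{1..<j}. extreme_block blk k H v j';
     W = vert (convex hull (slice blk k H v j));
     \<forall>w\<in>W. 0 \<le> \<mu> w; (\<Sum>w\<in>W. \<mu> w) = 1; block blk j v = (\<Sum>w\<in>W. \<mu> w *\<^sub>R w);
     N = replace_block blk j v ` {w\<in>W. 0 < \<mu> w};
     distinct us; set us = N - (X \<union> set U) \<rbrakk> \<Longrightarrow>
     mc_step blk k H (X, v # U, T)
       (X \<union> set us, us @ U, \<lambda>a b. if a = v \<and> b \<in> N then \<mu> (block blk j b) else T a b)"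

definition mc_reachable ::
    "('n::finite \<Rightarrow> nat) \<Rightarrow> nat \<Rightarrow> nat \<Rightarrow> (nat \<Rightarrow> nat \<Rightarrow> (real ^ 'n) set) \<Rightarrow> 'n mc_state \<Rightarrow> bool" where
  "mc_reachable blk k n P s \<longleftrightarrow>
     (\<exists>s0. mc_init blk k n P s0 \<and> (mc_step blk k (region blk k n P))\<^sup>*\<^sup>* s0 s)"

text \<open>
  No run is infinite, and no run gets stuck before the stack is empty (in particular, the required
  convex representation always exists).
\<close>

definition mc_terminates ::
    "('n::finite \<Rightarrow> nat) \<Rightarrow> nat \<Rightarrow> nat \<Rightarrow> (nat \<Rightarrow> nat \<Rightarrow> (real ^ 'n) set) \<Rightarrow> bool" where
  "mc_terminates blk k n P \<longleftrightarrow>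
     (\<exists>s. mc_init blk k n P s) \<and>
     (\<nexists>\<sigma>. mc_init blk k n P (\<sigma> 0) \<and>
          (\<forall>t. mc_step blk k (region blk k n P) (\<sigma> t) (\<sigma> (Suc t)))) \<and>
     (\<forall>X U T. mc_reachable blk k n P (X, U, T) \<and> U \<noteq> [] \<longrightarrow>
          (\<exists>s. mc_step blk k (region blk k n P) (X, U, T) s))"

definition mc_returns ::
    "('n::finite \<Rightarrow> nat) \<Rightarrow> nat \<Rightarrow> nat \<Rightarrow> (nat \<Rightarrow> nat \<Rightarrow> (real ^ 'n) set) \<Rightarrow>
     (real ^ 'n) set \<Rightarrow> (real ^ 'n \<Rightarrow> real ^ 'n \<Rightarrow> real) \<Rightarrow> bool" where
  "mc_returns blk k n P X T \<longleftrightarrow> mc_reachable blk k n P (X, [], T)"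


definition finite_markov_chain :: "'a set \<Rightarrow> ('a \<Rightarrow> 'a \<Rightarrow> real) \<Rightarrow> bool" where
  "finite_markov_chain X T \<longleftrightarrow>
     finite X \<and> X \<noteq> {} \<and> (\<forall>x\<in>X. \<forall>y\<in>X. 0 \<le> T x y) \<and> (\<forall>x\<in>X. (\<Sum>y\<in>X. T x y) = 1)"

definition absorbing_states :: "'a set \<Rightarrow> ('a \<Rightarrow> 'a \<Rightarrow> real) \<Rightarrow> 'a set" where
  "absorbing_states X T = {x\<in>X. T x x = 1}"

definition absorbing_chain :: "'a set \<Rightarrow> ('a \<Rightarrow> 'a \<Rightarrow> real) \<Rightarrow> bool" where
  "absorbing_chain X T \<longleftrightarrow>
     finite_markov_chain X T \<and> absorbing_states X T \<noteq> {} \<and>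
     (\<forall>x\<in>X. \<exists>y\<in>absorbing_states X T. (x, y) \<in> {(a, b). a \<in> X \<and> b \<in> X \<and> 0 < T a b}\<^sup>*)"

fun trans_pow :: "'a set \<Rightarrow> ('a \<Rightarrow> 'a \<Rightarrow> real) \<Rightarrow> nat \<Rightarrow> 'a \<Rightarrow> 'a \<Rightarrow> real" where
  "trans_pow X T 0 x y = (if x = y then 1 else 0)"
| "trans_pow X T (Suc t) x y = (\<Sum>z\<in>X. T x z * trans_pow X T t z y)"

definition trans_lim :: "'a set \<Rightarrow> ('a \<Rightarrow> 'a \<Rightarrow> real) \<Rightarrow> 'a \<Rightarrow> 'a \<Rightarrow> real" where
  "trans_lim X T x y = lim (\<lambda>t. trans_pow X T t x y)"

end

theory Submission
  imports Defs
begin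

text \<open>
  Every state \<open>v\<close> of the constructed chain is the barycentre of its successors with respect to its
  row of transition probabilities: the algorithm writes one block of \<open>v\<close> as a convex combination
  and keeps the others. A multilinear function is affine in that block, so it is harmonic for the
  chain (\<open>multilinear_block_combination\<close>, \<open>move_row\<close>).

  A finite chain on points of an inner product space whose states are barycentres of their
  successors is absorbing. By strict convexity of the squared norm, a state \<open>v\<close> with
  \<open>T v v \<noteq> 1\<close> has a successor of larger norm, and the expected squared norm grows in one step from
  \<open>v\<close> by a positive amount. The former gives reachability of an absorbing state
  (\<open>barycentric_chain_absorbing\<close>); the latter, as the expected squared norm stays bounded, forces
  the probability of being in a nonabsorbing state to tend to \<open>0\<close>
  (\<open>barycentric_chain_transient\<close>). The probability of being in a given absorbing state is
  nondecreasing in time, so \<open>T\<^sup>t\<close> converges, and the value of a harmonic function at \<open>x\<close> is its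
  mean over the absorbing states with the weights \<open>T\<^sup>* (x, \<cdot>)\<close>
  (\<open>barycentric_chain_harmonic\<close>). This yields the first representation for \<open>M\<close> and, since the
  coordinates are multilinear too, for the point itself (\<open>graph_combination\<close>). The second
  one results from expanding \<open>M x\<close> block by block over the vertices of \<open>P\<^sub>i\<close>
  (\<open>multilinear_expansion\<close>), which are states of the chain.

  Runs are finite because the states stay in a finite grid: the convex hull of a slice is spanned by
  the vertices of the polytopes \<open>P\<^sub>i\<^sub>j\<close> that make up the slice (\<open>hull_slice\<close>), so every block of a
  state is a vertex of some \<open>P\<^sub>i\<^sub>j\<close>, and each iteration processes a new state. A corner point is a
  vertex of every \<open>P\<^sub>i\<close> that contains it (\<open>corner_subset_disc\<close>), so all corner points are states.
\<close>

section \<open>Finite Markov chains whose states are barycentres of their successors\<close>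

lemma finite_markov_chainD:
  assumes "finite_markov_chain X T"
  shows "finite X" "X \<noteq> {}" "\<And>x y. \<lbrakk>x \<in> X; y \<in> X\<rbrakk> \<Longrightarrow> 0 \<le> T x y"
    "\<And>x. x \<in> X \<Longrightarrow> (\<Sum>y\<in>X. T x y) = 1"
  using assms by (auto simp: finite_markov_chain_def)

lemma trans_pow_nonneg:
  assumes "finite_markov_chain X T" "x \<in> X" "y \<in> X"
  shows "0 \<le> trans_pow X T t x y"
  using assms(2)
proof (induction t arbitrary: x)
  case (Suc t)
  then show ?case
    using finite_markov_chainD[OF assms(1)] by (auto intro!: sum_nonneg mult_nonneg_nonneg)
qed simp

lemma trans_pow_Suc_right:
  assumes "finite X" "x \<in> X" "y \<in> X"
  shows "trans_pow X T (Suc t) x y = (\<Sum>z\<in>X. trans_pow X T t x z * T z y)"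
  using assms(2)
proof (induction t arbitrary: x)
  case 0
  have "(\<Sum>z\<in>X. T x z * (if z = y then 1 else 0)) = (\<Sum>z\<in>X. if z = y then T x z else 0)"
    "(\<Sum>z\<in>X. (if x = z then 1 else 0) * T z y) = (\<Sum>z\<in>X. if x = z then T z y else 0)"
    by (auto intro: sum.cong)
  then show ?case using assms 0 by (simp add: sum.delta)
next
  case (Suc t)
  have "trans_pow X T (Suc (Suc t)) x y = (\<Sum>z\<in>X. T x z * trans_pow X T (Suc t) z y)"
    by simp
  also have "\<dots> = (\<Sum>z\<in>X. T x z * (\<Sum>u\<in>X. trans_pow X T t z u * T u y))"
    using Suc.IH by (intro sum.cong) (auto simp del: trans_pow.simps)
  also have "\<dots> = (\<Sum>u\<in>X. (\<Sum>z\<in>X. T x z * trans_pow X T t z u) * T u y)"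
    unfolding sum_distrib_left sum_distrib_right
    by (subst sum.swap) (simp add: mult.assoc)
  finally show ?case by simp
qed

lemma trans_pow_harmonic:
  fixes h :: "'a \<Rightarrow> real"
  assumes "finite X" "\<forall>x\<in>X. (\<Sum>y\<in>X. T x y * h y) = h x" "x \<in> X"
  shows "(\<Sum>y\<in>X. trans_pow X T t x y * h y) = h x"
  using assms(3)
proof (induction t arbitrary: x)
  case 0
  have "(\<Sum>y\<in>X. trans_pow X T 0 x y * h y) = (\<Sum>y\<in>X. if x = y then h y else 0)"
    by (auto intro: sum.cong)
  then show ?case using assms(1) 0 by (simp add: sum.delta)
next
  case (Suc t)
  have "(\<Sum>y\<in>X. trans_pow X T (Suc t) x y * h y)
      = (\<Sum>z\<in>X. T x z * (\<Sum>y\<in>X. trans_pow X T t z y * h y))"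
    unfolding trans_pow.simps sum_distrib_left sum_distrib_right
    by (subst sum.swap) (simp add: mult.assoc)
  also have "\<dots> = (\<Sum>z\<in>X. T x z * h z)"
    using Suc.IH by (intro sum.cong) auto
  finally show ?case using assms(2) Suc.prems by simp
qed

lemma trans_pow_le_1:
  assumes "finite_markov_chain X T" "x \<in> X" "y \<in> X"
  shows "trans_pow X T t x y \<le> 1"
proof -
  note * = finite_markov_chainD[OF assms(1)]
  have "trans_pow X T t x y \<le> (\<Sum>z\<in>X. trans_pow X T t x z)"
    using * assms trans_pow_nonneg[OF assms(1)] by (intro member_le_sum) auto
  also have "\<dots> = 1"
    using trans_pow_harmonic[of X T "\<lambda>_. 1" x t] * assms by simp
  finally show ?thesis .
qed

text \<open>The row of \<open>x\<close> is a probability distribution with mean \<open>x\<close>; both sides are its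
  variance.\<close>
lemma barycentric_norm_increase:
  fixes X :: "'a::real_inner set"
  assumes "finite_markov_chain X T" "\<forall>x\<in>X. (\<Sum>y\<in>X. T x y *\<^sub>R y) = x" "x \<in> X"
  shows "(\<Sum>y\<in>X. T x y * (norm y)\<^sup>2) - (norm x)\<^sup>2 = (\<Sum>y\<in>X. T x y * (norm (y - x))\<^sup>2)"
proof -
  note * = finite_markov_chainD[OF assms(1)]
  have "(\<Sum>y\<in>X. T x y * (norm (y - x))\<^sup>2)
      = (\<Sum>y\<in>X. T x y * (norm y)\<^sup>2 - 2 * (x \<bullet> (T x y *\<^sub>R y)) + T x y * (norm x)\<^sup>2)"
    by (intro sum.cong refl)
      (simp add: power2_norm_eq_inner inner_diff_left inner_diff_right inner_commute algebra_simps)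
  also have "\<dots> = (\<Sum>y\<in>X. T x y * (norm y)\<^sup>2) - 2 * (x \<bullet> (\<Sum>y\<in>X. T x y *\<^sub>R y))
      + (\<Sum>y\<in>X. T x y) * (norm x)\<^sup>2"
    by (simp add: sum.distrib sum_subtractf sum_distrib_left sum_distrib_right inner_sum_right)
  also have "\<dots> = (\<Sum>y\<in>X. T x y * (norm y)\<^sup>2) - (norm x)\<^sup>2"
    using assms(2,3) * by (simp add: power2_norm_eq_inner)
  finally show ?thesis by simp
qed

lemma norm_increase_nonneg:
  fixes X :: "'a::real_inner set"
  assumes "finite_markov_chain X T" "x \<in> X"
  shows "0 \<le> (\<Sum>y\<in>X. T x y * (norm (y - x))\<^sup>2)"
  using finite_markov_chainD[OF assms(1)] assms(2) by (auto intro!: sum_nonneg)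

text \<open>A row with sum \<open>1\<close> and \<open>T x x \<noteq> 1\<close> puts positive weight on some point other than \<open>x\<close>.\<close>
lemma norm_increase_pos:
  fixes X :: "'a::real_inner set"
  assumes "finite_markov_chain X T" "x \<in> X" "T x x \<noteq> 1"
  shows "0 < (\<Sum>y\<in>X. T x y * (norm (y - x))\<^sup>2)"
proof -
  note * = finite_markov_chainD[OF assms(1)]
  have "\<exists>y\<in>X. y \<noteq> x \<and> T x y \<noteq> 0"
  proof (rule ccontr)
    assume "\<not> ?thesis"
    then have "(\<Sum>y\<in>X. T x y) = (\<Sum>y\<in>{x}. T x y)"
      using * assms(2) by (intro sum.mono_neutral_right) auto
    then show False using * assms by simp
  qed
  then obtain y where "y \<in> X" "y \<noteq> x" "T x y > 0"
    using *(3)[of x] assms(2) by (metis order_le_less)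
  then show ?thesis
    using * assms by (intro sum_pos2[of X y]) auto
qed

lemma barycentric_chain_absorbing:
  fixes X :: "'a::real_inner set"
  assumes mc: "finite_markov_chain X T"
    and bary: "\<forall>x\<in>X. (\<Sum>y\<in>X. T x y *\<^sub>R y) = x"
  shows "absorbing_chain X T"
proof -
  note * = finite_markov_chainD[OF mc]
  let ?R = "{(a, b). a \<in> X \<and> b \<in> X \<and> 0 < T a b}"
  have reach: "\<exists>y\<in>absorbing_states X T. (x, y) \<in> ?R\<^sup>*" if "x \<in> X" for x
    using that
  proof (induction "card {y\<in>X. norm x < norm y}" arbitrary: x rule: less_induct)
    case less
    show ?case
    proof (cases "T x x = 1")
      case True
      then show ?thesis using less.prems by (auto simp: absorbing_states_def)
    next
      case False
      have "\<exists>u\<in>X. 0 < T x u \<and> norm x < norm u"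
      proof (rule ccontr)
        assume no_increase: "\<not> ?thesis"
        have "T x u * (norm u)\<^sup>2 \<le> T x u * (norm x)\<^sup>2" if "u \<in> X" for u
        proof (cases "0 < T x u")
          case True
          then have "norm u \<le> norm x"
            using no_increase that by (auto simp: not_less)
          then show ?thesis
            using True by (intro mult_left_mono power_mono) auto
        next
          case False
          then show ?thesis
            using *(3)[OF less.prems that] by simp
        qed
        then have "(\<Sum>u\<in>X. T x u * (norm u)\<^sup>2) \<le> (\<Sum>u\<in>X. T x u * (norm x)\<^sup>2)"
          by (rule sum_mono)
        also have "\<dots> = (norm x)\<^sup>2"
          using *(4)[OF less.prems] by (simp flip: sum_distrib_right)
        finally show False
          using norm_increase_pos[OF mc less.prems False]
            barycentric_norm_increase[OF mc bary less.prems] by simp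
      qed
      then obtain u where u: "u \<in> X" "0 < T x u" "norm x < norm u" by blast
      have "{y\<in>X. norm u < norm y} \<subset> {y\<in>X. norm x < norm y}"
        using u by force
      then have "card {y\<in>X. norm u < norm y} < card {y\<in>X. norm x < norm y}"
        using *(1) by (intro psubset_card_mono) auto
      then obtain y where "y \<in> absorbing_states X T" "(u, y) \<in> ?R\<^sup>*"
        using less.hyps u(1) by blast
      moreover have "(x, u) \<in> ?R" using u less.prems by simp
      ultimately show ?thesis by (meson converse_rtrancl_into_rtrancl)
    qed
  qed
  moreover have "absorbing_states X T \<noteq> {}"
    using reach *(2) by fastforce
  ultimately show ?thesis
    using mc by (simp add: absorbing_chain_def)
qed

text \<open>The mean squared norm after \<open>t\<close> steps is nondecreasing and bounded, so its increments
  tend to \<open>0\<close>; each increment dominates a fixed positive multiple of the probability of being at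
  \<open>y\<close>.\<close>
lemma barycentric_chain_transient:
  fixes X :: "'a::real_inner set"
  assumes mc: "finite_markov_chain X T"
    and bary: "\<forall>x\<in>X. (\<Sum>y\<in>X. T x y *\<^sub>R y) = x"
    and x: "x \<in> X" and y: "y \<in> X" and "T y y \<noteq> 1"
  shows "(\<lambda>t. trans_pow X T t x y) \<longlonglongrightarrow> 0"
proof -
  note * = finite_markov_chainD[OF mc]
  define F where "F t = (\<Sum>z\<in>X. trans_pow X T t x z * (norm z)\<^sup>2)" for t
  define g where "g z = (\<Sum>u\<in>X. T z u * (norm (u - z))\<^sup>2)" for z
  have g0: "0 \<le> g z" if "z \<in> X" for z
    unfolding g_def by (rule norm_increase_nonneg[OF mc that])
  have gy: "0 < g y"
    unfolding g_def by (rule norm_increase_pos[OF mc y]) fact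
  have "F (Suc t) - F t = (\<Sum>z\<in>X. trans_pow X T t x z * g z)" for t
  proof -
    have "F (Suc t) = (\<Sum>u\<in>X. (\<Sum>z\<in>X. trans_pow X T t x z * T z u) * (norm u)\<^sup>2)"
      unfolding F_def using trans_pow_Suc_right[OF *(1) x]
      by (intro sum.cong) (auto simp del: trans_pow.simps)
    also have "\<dots> = (\<Sum>z\<in>X. trans_pow X T t x z * (\<Sum>u\<in>X. T z u * (norm u)\<^sup>2))"
      unfolding sum_distrib_left sum_distrib_right
      by (subst sum.swap) (simp add: mult.assoc)
    finally have "F (Suc t) - F t
        = (\<Sum>z\<in>X. trans_pow X T t x z * ((\<Sum>u\<in>X. T z u * (norm u)\<^sup>2) - (norm z)\<^sup>2))"
      by (simp add: F_def sum_subtractf right_diff_distrib)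
    also have "\<dots> = (\<Sum>z\<in>X. trans_pow X T t x z * g z)"
      using barycentric_norm_increase[OF mc bary] by (intro sum.cong) (auto simp: g_def)
    finally show ?thesis .
  qed
  note inc = this
  have lower: "trans_pow X T t x y * g y \<le> F (Suc t) - F t" for t
    unfolding inc using trans_pow_nonneg[OF mc x] g0 *(1) y
    by (intro member_le_sum) auto
  have "incseq F"
  proof (rule incseq_SucI)
    fix t
    have "0 \<le> trans_pow X T t x y * g y"
      using trans_pow_nonneg[OF mc x y] gy by simp
    then show "F t \<le> F (Suc t)" using lower[of t] by simp
  qed
  moreover have "F t \<le> (\<Sum>z\<in>X. (norm z)\<^sup>2)" for t
    unfolding F_def using trans_pow_le_1[OF mc x]
    by (intro sum_mono mult_left_le_one_le) (auto intro: trans_pow_nonneg[OF mc x])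
  ultimately obtain L where L: "F \<longlonglongrightarrow> L"
    using incseq_convergent[of F] by metis
  have "(\<lambda>t. F (Suc t) - F t) \<longlonglongrightarrow> L - L"
    using L by (intro tendsto_diff LIMSEQ_Suc)
  then have "(\<lambda>t. (F (Suc t) - F t) / g y) \<longlonglongrightarrow> 0"
    using tendsto_divide_zero by fastforce
  moreover have "\<forall>t. trans_pow X T t x y \<le> (F (Suc t) - F t) / g y"
    using lower gy by (simp add: pos_le_divide_eq)
  ultimately show ?thesis
    using trans_pow_nonneg[OF mc x y]
    by (auto intro: tendsto_sandwich[where f = "\<lambda>_. 0" and h = "\<lambda>t. (F (Suc t) - F t) / g y"])
qed

lemma absorbing_state_convergent:
  assumes mc: "finite_markov_chain X T" and x: "x \<in> X" and y: "y \<in> X" and "T y y = 1"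
  shows "convergent (\<lambda>t. trans_pow X T t x y)"
proof -
  note * = finite_markov_chainD[OF mc]
  have "incseq (\<lambda>t. trans_pow X T t x y)"
  proof (rule incseq_SucI)
    fix t
    have "trans_pow X T t x y * T y y \<le> (\<Sum>z\<in>X. trans_pow X T t x z * T z y)"
      using * trans_pow_nonneg[OF mc x] y by (intro member_le_sum) auto
    then show "trans_pow X T t x y \<le> trans_pow X T (Suc t) x y"
      unfolding trans_pow_Suc_right[OF *(1) x y] using \<open>T y y = 1\<close> by simp
  qed
  then obtain L where "(\<lambda>t. trans_pow X T t x y) \<longlonglongrightarrow> L"
    using trans_pow_le_1[OF mc x y] by (auto elim: incseq_convergent[where B = 1])
  then show ?thesis by (rule convergentI)
qed

lemma barycentric_chain_tendsto:
  fixes X :: "'a::real_inner set"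
  assumes mc: "finite_markov_chain X T"
    and bary: "\<forall>x\<in>X. (\<Sum>y\<in>X. T x y *\<^sub>R y) = x"
    and x: "x \<in> X" and y: "y \<in> X"
  shows "(\<lambda>t. trans_pow X T t x y) \<longlonglongrightarrow> trans_lim X T x y"
proof -
  have "convergent (\<lambda>t. trans_pow X T t x y)"
    using convergentI[OF barycentric_chain_transient[OF mc bary x y]]
      absorbing_state_convergent[OF mc x y] by argo
  then show ?thesis
    by (simp add: trans_lim_def convergent_LIMSEQ_iff)
qed

lemma barycentric_chain_harmonic:
  fixes X :: "'a::real_inner set" and h :: "'a \<Rightarrow> real"
  assumes mc: "finite_markov_chain X T"
    and bary: "\<forall>x\<in>X. (\<Sum>y\<in>X. T x y *\<^sub>R y) = x"
    and harm: "\<forall>x\<in>X. (\<Sum>y\<in>X. T x y * h y) = h x" and x: "x \<in> X"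
  shows "h x = (\<Sum>v\<in>absorbing_states X T. trans_lim X T x v * h v)"
proof -
  note * = finite_markov_chainD[OF mc]
  have "(\<lambda>t. \<Sum>y\<in>X. trans_pow X T t x y * h y) \<longlonglongrightarrow> (\<Sum>y\<in>X. trans_lim X T x y * h y)"
    using barycentric_chain_tendsto[OF mc bary x] by (intro tendsto_intros)
  then have "h x = (\<Sum>y\<in>X. trans_lim X T x y * h y)"
    unfolding trans_pow_harmonic[of X T h, OF *(1) harm x]
    by (simp only: LIMSEQ_const_iff)
  also have "\<dots> = (\<Sum>v\<in>absorbing_states X T. trans_lim X T x v * h v)"
  proof (intro sum.mono_neutral_right *(1) ballI)
    fix y assume y: "y \<in> X - absorbing_states X T"
    then have "T y y \<noteq> 1" by (simp add: absorbing_states_def)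
    then have "trans_lim X T x y = 0"
      using limI[OF barycentric_chain_transient[OF mc bary x]] y
      by (simp add: trans_lim_def)
    then show "trans_lim X T x y * h y = 0" by simp
  qed (auto simp: absorbing_states_def)
  finally show ?thesis .
qed


section \<open>Blocks and multilinear functions\<close>

lemma block_nth [simp]: "block blk j x $ c = (if blk c = j then x $ c else 0)"
  by (simp add: block_def)

lemma replace_block_nth [simp]: "replace_block blk j x y $ c = (if blk c = j then y $ c else x $ c)"
  by (simp add: replace_block_def)

lemma block_in_block_space [simp]: "block blk j x \<in> block_space blk j"
  by (simp add: block_space_def)

lemma block_of_block_space: "y \<in> block_space blk j \<Longrightarrow> block blk j y = y"
  by (auto simp: block_space_def vec_eq_iff)

lemma linear_block: "linear (block blk j)"
  by (rule linearI) (auto simp: vec_eq_iff)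

lemma block_replace_block:
  "block blk i (replace_block blk j x y) = (if i = j then block blk j y else block blk i x)"
  by (auto simp: vec_eq_iff)

lemma replace_block_block [simp]: "replace_block blk j x (block blk j x) = x"
  by (auto simp: vec_eq_iff)

lemma replace_block_decompose:
  "replace_block blk j x y = (x - block blk j x) + block blk j y"
  by (auto simp: vec_eq_iff)

lemma blocks_eqI:
  assumes "\<forall>c. blk c \<in> {1..k}" "\<And>j. j \<in> {1..k} \<Longrightarrow> block blk j x = block blk j y"
  shows "x = y"
  unfolding vec_eq_iff
proof
  fix c
  have "block blk (blk c) x $ c = block blk (blk c) y $ c"
    using assms by metis
  then show "x $ c = y $ c" by simp
qed

lemma block_prodD: "\<lbrakk>x \<in> block_prod blk k Q; j \<in> {1..k}\<rbrakk> \<Longrightarrow> block blk j x \<in> Q j"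
  by (simp add: block_prod_def)

lemma finite_block_prod:
  assumes "\<forall>c. blk c \<in> {1..k}" "\<And>j. j \<in> {1..k} \<Longrightarrow> finite (Q j)"
  shows "finite (block_prod blk k Q)"
proof (rule inj_on_finite[where f = "\<lambda>x. \<lambda>j\<in>{1..k}. block blk j x"])
  show "inj_on (\<lambda>x. \<lambda>j\<in>{1..k}. block blk j x) (block_prod blk k Q)"
  proof (rule inj_onI, rule blocks_eqI[OF assms(1)])
    fix x y j
    assume eq: "(\<lambda>j\<in>{1..k}. block blk j x) = (\<lambda>j\<in>{1..k}. block blk j y)" and j: "j \<in> {1..k}"
    show "block blk j x = block blk j y"
      using fun_cong[OF eq, of j] j by (simp only: restrict_apply')
  qed
  show "(\<lambda>x. \<lambda>j\<in>{1..k}. block blk j x) ` block_prod blk k Q \<subseteq> Pi\<^sub>E {1..k} Q"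
    by (auto simp: block_prod_def)
  show "finite (Pi\<^sub>E {1..k} Q)"
    using assms(2) by (auto intro: finite_PiE)
qed

lemma open_segment_block:
  assumes "v \<in> open_segment a b" "block blk j a \<noteq> block blk j b"
  shows "block blk j v \<in> open_segment (block blk j a) (block blk j b)"
proof -
  interpret linear "block blk j" by (rule linear_block)
  show ?thesis
    using assms by (auto simp: in_segment add scale)
qed

lemma open_segment_replace_block:
  assumes "block blk j v \<in> open_segment a b" "a \<in> block_space blk j" "b \<in> block_space blk j"
  shows "v \<in> open_segment (replace_block blk j v a) (replace_block blk j v b)"
proof -
  obtain u where u: "a \<noteq> b" "0 < u" "u < 1" "block blk j v = (1 - u) *\<^sub>R a + u *\<^sub>R b"
    using assms(1) by (auto simp: in_segment)
  have "v = (v - block blk j v) + block blk j v" by simp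
  also have "\<dots> = (1 - u) *\<^sub>R ((v - block blk j v) + a) + u *\<^sub>R ((v - block blk j v) + b)"
    by (subst (2) u(4)) (simp add: algebra_simps)
  finally show ?thesis
    using u(1-3) assms(2,3)
    by (auto simp: in_segment replace_block_decompose block_of_block_space)
qed

lemma vert_block_prod:
  assumes blk: "\<forall>c. blk c \<in> {1..k}" and Q: "\<And>j. j \<in> {1..k} \<Longrightarrow> Q j \<subseteq> block_space blk j"
  shows "vert (block_prod blk k Q) = block_prod blk k (\<lambda>j. vert (Q j))"
proof (intro equalityI subsetI)
  fix v assume v: "v \<in> vert (block_prod blk k Q)"
  show "v \<in> block_prod blk k (\<lambda>j. vert (Q j))"
    unfolding block_prod_def
  proof (intro CollectI ballI)
    fix j assume j: "j \<in> {1..k}"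
    have vQ: "v \<in> block_prod blk k Q"
      using v by (simp add: vert_def extreme_point_of_def)
    have "block blk j v \<notin> open_segment a b" if ab: "a \<in> Q j" "b \<in> Q j" for a b
    proof
      assume "block blk j v \<in> open_segment a b"
      then have "v \<in> open_segment (replace_block blk j v a) (replace_block blk j v b)"
        using ab Q[OF j] by (intro open_segment_replace_block) auto
      moreover have "replace_block blk j v w \<in> block_prod blk k Q" if "w \<in> Q j" for w
        using vQ that Q[OF j]
        by (auto simp: block_prod_def block_replace_block block_of_block_space subsetD)
      ultimately show False
        using v ab by (auto simp: vert_def extreme_point_of_def)
    qed
    then show "block blk j v \<in> vert (Q j)"
      using vQ j by (auto simp: vert_def extreme_point_of_def block_prod_def)
  qed
next
  fix v assume v: "v \<in> block_prod blk k (\<lambda>j. vert (Q j))"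
  have "v \<notin> open_segment a b" if ab: "a \<in> block_prod blk k Q" "b \<in> block_prod blk k Q" for a b
  proof
    assume seg: "v \<in> open_segment a b"
    then have "a \<noteq> b" by (auto simp: in_segment)
    then obtain j where j: "j \<in> {1..k}" "block blk j a \<noteq> block blk j b"
      using blocks_eqI[OF blk] by blast
    then have "block blk j v \<in> open_segment (block blk j a) (block blk j b)"
      using seg by (intro open_segment_block)
    then show False
      using v ab j by (auto simp: block_prod_def vert_def extreme_point_of_def)
  qed
  then show "v \<in> vert (block_prod blk k Q)"
    using v by (auto simp: vert_def extreme_point_of_def block_prod_def)
qed

lemma multilinear_block_combination:
  assumes M: "multilinear blk k M" and j: "j \<in> {1..k}" and W: "W \<subseteq> block_space blk j"
    and \<mu>: "(\<Sum>w\<in>W. \<mu> w) = 1" "block blk j x = (\<Sum>w\<in>W. \<mu> w *\<^sub>R w)"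
  shows "M x = (\<Sum>w\<in>W. \<mu> w * M (replace_block blk j x w))"
proof -
  obtain f c where f: "linear f" "\<And>y. y \<in> block_space blk j \<Longrightarrow> M (replace_block blk j x y) = f y + c"
    using M j unfolding multilinear_def by meson
  have "M x = f (block blk j x) + c"
    using f(2)[of "block blk j x"] by simp
  also have "\<dots> = (\<Sum>w\<in>W. \<mu> w * f w) + (\<Sum>w\<in>W. \<mu> w) * c"
    using \<mu> by (simp add: linear_sum[OF f(1)] linear_scale[OF f(1)])
  also have "\<dots> = (\<Sum>w\<in>W. \<mu> w * (f w + c))"
    by (simp add: sum_distrib_right sum.distrib distrib_left)
  also have "\<dots> = (\<Sum>w\<in>W. \<mu> w * M (replace_block blk j x w))"
    using W by (intro sum.cong) (auto simp: f(2))
  finally show ?thesis .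
qed

text \<open>A coordinate depends on one block only, on which it is linear.\<close>
lemma multilinear_nth: "multilinear blk k (\<lambda>x. x $ c)"
  unfolding multilinear_def
proof (intro ballI allI)
  fix j and x :: "real ^ 'a"
  show "\<exists>f d. linear f \<and> (\<forall>y\<in>block_space blk j. replace_block blk j x y $ c = f y + d)"
  proof (cases "blk c = j")
    case True
    have "linear (\<lambda>y::real ^ 'a. y $ c)" by (rule linearI) auto
    then show ?thesis using True by (intro exI[of _ "\<lambda>y. y $ c"] exI[of _ 0]) simp
  next
    case False
    have "linear (\<lambda>y::real ^ 'a. 0::real)" by (rule linearI) auto
    then show ?thesis using False by (intro exI[of _ "\<lambda>y. 0"] exI[of _ "x $ c"]) simp
  qed
qed

lemma multilinear_const: "multilinear blk k (\<lambda>_. c)"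
proof -
  have "linear (\<lambda>y::real ^ 'a. 0::real)" by (rule linearI) auto
  then show ?thesis unfolding multilinear_def by (auto intro!: exI[of _ "\<lambda>y. 0"])
qed

text \<open>The coordinates are themselves multilinear, so a formula for the values of all multilinear
  functions at \<open>x\<close> is also a formula for \<open>x\<close>.\<close>
lemma graph_combination:
  fixes x :: "real ^ 'n::finite"
  assumes M: "multilinear blk k M"
    and comb: "\<And>M. multilinear blk k M \<Longrightarrow> M x = (\<Sum>a\<in>A. p a * M a)"
  shows "(x, M x) = (\<Sum>a\<in>A. p a *\<^sub>R (a, M a))"
proof -
  have "x = (\<Sum>a\<in>A. p a *\<^sub>R a)"
    using comb[OF multilinear_nth] by (auto simp: vec_eq_iff)
  then show ?thesis
    using comb[OF M] by (auto simp: prod_eq_iff fst_sum snd_sum)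
qed

text \<open>The blocks \<open>1, \<dots>, m\<close> are expanded one after another; the products of the first \<open>m\<close>
  factors weigh the points whose first \<open>m\<close> blocks lie in \<open>V\<close> and whose other blocks are those
  of \<open>x\<close>.\<close>
lemma multilinear_expansion:
  assumes blk: "\<forall>c. blk c \<in> {1..k}" and M: "multilinear blk k M"
    and V: "\<And>j. j \<in> {1..k} \<Longrightarrow> V j \<subseteq> block_space blk j"
    and l1: "\<And>j. j \<in> {1..k} \<Longrightarrow> (\<Sum>w\<in>V j. l j w) = 1"
    and lx: "\<And>j. j \<in> {1..k} \<Longrightarrow> block blk j x = (\<Sum>w\<in>V j. l j w *\<^sub>R w)"
  shows "M x = (\<Sum>v\<in>block_prod blk k V. (\<Prod>j=1..k. l j (block blk j v)) * M v)"
proof -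
  define A where "A m = {v. \<forall>j\<in>{1..k}. (j \<le> m \<longrightarrow> block blk j v \<in> V j) \<and>
      (m < j \<longrightarrow> block blk j v = block blk j x)}" for m
  have "M x = (\<Sum>v\<in>A m. (\<Prod>j=1..m. l j (block blk j v)) * M v)" if "m \<le> k" for m
    using that
  proof (induction m)
    case 0
    have "A 0 = {x}"
      unfolding A_def using blocks_eqI[OF blk, of _ x] by auto
    then show ?case by simp
  next
    case (Suc m)
    let ?j = "Suc m" and ?r = "\<lambda>(v, w). replace_block blk (Suc m) v w"
    have j: "?j \<in> {1..k}" using Suc.prems by simp
    have Vj: "block blk ?j w = w" if "w \<in> V ?j" for w
      using V[OF j] that by (auto intro: block_of_block_space)
    have Aj: "block blk ?j v = block blk ?j x" if "v \<in> A m" for v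
      using that j by (simp add: A_def)
    have inj: "inj_on ?r (A m \<times> V ?j)"
    proof (rule inj_onI, clarify)
      fix v w v' w'
      assume *: "v \<in> A m" "w \<in> V ?j" "v' \<in> A m" "w' \<in> V ?j"
        and eq: "replace_block blk ?j v w = replace_block blk ?j v' w'"
      have "block blk i v = block blk i v'" for i
      proof (cases "i = ?j")
        case True
        then show ?thesis using Aj[of v] Aj[of v'] * by metis
      next
        case False
        then show ?thesis
          using arg_cong[OF eq, of "block blk i"] by (simp add: block_replace_block)
      qed
      moreover have "w = w'"
        using arg_cong[OF eq, of "block blk ?j"] * Vj by (simp add: block_replace_block)
      ultimately show "v = v' \<and> w = w'"
        using blocks_eqI[OF blk, of v v'] by auto
    qed
    have img: "?r ` (A m \<times> V ?j) = A ?j"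
    proof (intro equalityI subsetI)
      fix u assume "u \<in> ?r ` (A m \<times> V ?j)"
      then obtain v w where "v \<in> A m" "w \<in> V ?j" "u = replace_block blk ?j v w" by auto
      then show "u \<in> A ?j"
        using Vj by (simp add: A_def block_replace_block le_Suc_eq)
    next
      fix u assume u: "u \<in> A ?j"
      have "u = replace_block blk ?j (replace_block blk ?j u x) (block blk ?j u)"
        by (simp add: vec_eq_iff)
      moreover have "replace_block blk ?j u x \<in> A m"
        using u by (simp add: A_def block_replace_block)
      moreover have "block blk ?j u \<in> V ?j"
        using u j by (simp add: A_def)
      ultimately show "u \<in> ?r ` (A m \<times> V ?j)"
        by (intro image_eqI[where x = "(replace_block blk ?j u x, block blk ?j u)"]) simp_all
    qed
    have "M x = (\<Sum>v\<in>A m. (\<Prod>i=1..m. l i (block blk i v)) * M v)"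
      using Suc by simp
    also have "\<dots> = (\<Sum>v\<in>A m. \<Sum>w\<in>V ?j. (\<Prod>i=1..?j. l i (block blk i (?r (v, w)))) * M (?r (v, w)))"
    proof (rule sum.cong[OF refl])
      fix v assume v: "v \<in> A m"
      have "M v = (\<Sum>w\<in>V ?j. l ?j w * M (replace_block blk ?j v w))"
        using Aj[OF v] l1[OF j] lx[OF j] by (intro multilinear_block_combination[OF M j V[OF j]]) auto
      then show "(\<Prod>i=1..m. l i (block blk i v)) * M v
          = (\<Sum>w\<in>V ?j. (\<Prod>i=1..?j. l i (block blk i (?r (v, w)))) * M (?r (v, w)))"
        using Vj by (auto simp: sum_distrib_left block_replace_block mult.assoc intro!: sum.cong)
    qed
    also have "\<dots> = (\<Sum>p\<in>A m \<times> V ?j. (\<Prod>i=1..?j. l i (block blk i (?r p))) * M (?r p))"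
      by (simp add: sum.cartesian_product case_prod_unfold)
    also have "\<dots> = (\<Sum>v\<in>A ?j. (\<Prod>i=1..?j. l i (block blk i v)) * M v)"
      using sum.reindex[OF inj, of "\<lambda>v. (\<Prod>i=1..?j. l i (block blk i v)) * M v"]
      unfolding img by simp
    finally show ?case .
  qed
  moreover have "A k = block_prod blk k V"
    by (auto simp: A_def block_prod_def)
  ultimately show ?thesis by fastforce
qed


section \<open>Slices and corner points of an axis-aligned region\<close>

text \<open>The factors \<open>P i j\<close> may be empty; the pieces \<open>i\<close> with an empty factor do not contribute to
  the region.\<close>
locale axis_aligned =
  fixes blk :: "'n::finite \<Rightarrow> nat" and k n :: nat and P :: "nat \<Rightarrow> nat \<Rightarrow> (real ^ 'n) set"
  assumes blk: "\<forall>c. blk c \<in> {1..k}"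
    and polytope: "\<And>i j. \<lbrakk>i \<in> {1..n}; j \<in> {1..k}\<rbrakk> \<Longrightarrow> polytope (P i j)"
    and in_block_space: "\<And>i j. \<lbrakk>i \<in> {1..n}; j \<in> {1..k}\<rbrakk> \<Longrightarrow> P i j \<subseteq> block_space blk j"
begin

definition H :: "(real ^ 'n) set" where
  "H = region blk k n P"

text \<open>The points each of whose blocks is a vertex of some \<open>P\<^sub>i\<^sub>j\<close>, where \<open>i\<close> may depend on the
  block; every state that the algorithm visits is one of them.\<close>
definition grid :: "(real ^ 'n) set" where
  "grid = block_prod blk k (\<lambda>j. \<Union>i\<in>{1..n}. vert (P i j))"

lemma finite_vert: "\<lbrakk>i \<in> {1..n}; j \<in> {1..k}\<rbrakk> \<Longrightarrow> finite (vert (P i j))"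
  using polytope finite_polyhedron_extreme_points polytope_imp_polyhedron
  unfolding vert_def by blast

lemma hull_vert:
  assumes "i \<in> {1..n}" "j \<in> {1..k}"
  shows "P i j = convex hull (vert (P i j))"
  unfolding vert_def using polytope[OF assms]
  by (intro Krein_Milman_Minkowski) (auto simp: polytope_imp_compact polytope_imp_convex)

lemma vert_subset: "vert S \<subseteq> S"
  by (auto simp: vert_def extreme_point_of_def)

lemma finite_grid: "finite grid"
  unfolding grid_def using finite_vert by (intro finite_block_prod[OF blk]) auto

lemma k_pos: "1 \<in> {1..k}"
  using blk by (meson atLeastAtMost_iff le_trans order_refl)

lemma disc_subset_grid: "disc blk k n P \<subseteq> grid"
  by (auto simp: disc_def grid_def block_prod_def)

lemma disc_subset_H: "disc blk k n P \<subseteq> H"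
  using vert_subset by (fastforce simp: disc_def H_def region_def block_prod_def)

lemma vert_piece_subset_disc:
  assumes "i \<in> {1..n}"
  shows "vert (block_prod blk k (P i)) \<subseteq> disc blk k n P"
  using vert_block_prod[OF blk in_block_space[OF assms]] assms by (auto simp: disc_def)

lemma disc_nonempty:
  assumes "H \<noteq> {}"
  shows "disc blk k n P \<noteq> {}"
proof -
  obtain i x where i: "i \<in> {1..n}" and x: "x \<in> block_prod blk k (P i)"
    using assms unfolding H_def region_def by blast
  have "\<exists>w. w \<in> vert (P i j)" if "j \<in> {1..k}" for j
  proof -
    have "P i j \<noteq> {}" using block_prodD[OF x that] by blast
    then show ?thesis using hull_vert[OF i that] by fastforce
  qed
  then obtain w where w: "\<And>j. j \<in> {1..k} \<Longrightarrow> w j \<in> vert (P i j)"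
    by metis
  let ?v = "\<chi> c. w (blk c) $ c"
  have "block blk j ?v = w j" if "j \<in> {1..k}" for j
  proof -
    have "w j \<in> block_space blk j"
      using w[OF that] in_block_space[OF i that] vert_subset by blast
    then show ?thesis by (auto simp: vec_eq_iff block_space_def)
  qed
  then have "?v \<in> block_prod blk k (\<lambda>j. vert (P i j))"
    using w by (simp add: block_prod_def)
  then show ?thesis using i by (auto simp: disc_def)
qed

lemma slice_subset_block_space: "slice blk k H v j \<subseteq> block_space blk j"
  by (auto simp: slice_def)

lemma replace_block_slice:
  assumes "w \<in> slice blk k H v j"
  shows "replace_block blk j v w \<in> H"
proof -
  obtain x where x: "w = block blk j x" "x \<in> H"
    "\<forall>j'\<in>{1..k} - {j}. block blk j' x = block blk j' v"
    using assms by (auto simp: slice_def)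
  have "replace_block blk j v w = x"
  proof (rule blocks_eqI[OF blk])
    fix i assume "i \<in> {1..k}"
    then show "block blk i (replace_block blk j v w) = block blk i x"
      using x by (auto simp: block_replace_block block_of_block_space)
  qed
  then show ?thesis using x by simp
qed

lemma block_in_slice: "v \<in> H \<Longrightarrow> block blk j v \<in> slice blk k H v j"
  by (auto simp: slice_def)

lemma slice_eq:
  assumes j: "j \<in> {1..k}"
  shows "slice blk k H v j
    = (\<Union>i\<in>{i\<in>{1..n}. \<forall>j'\<in>{1..k} - {j}. block blk j' v \<in> P i j'}. P i j)"
proof (intro equalityI subsetI)
  fix w assume "w \<in> slice blk k H v j"
  then obtain x i where x: "w = block blk j x" "\<forall>j'\<in>{1..k} - {j}. block blk j' x = block blk j' v"
    and i: "i \<in> {1..n}" "x \<in> block_prod blk k (P i)"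
    by (auto simp: slice_def H_def region_def)
  have "\<forall>j'\<in>{1..k} - {j}. block blk j' v \<in> P i j'"
  proof
    fix j' assume "j' \<in> {1..k} - {j}"
    then show "block blk j' v \<in> P i j'"
      using x(2)[rule_format, of j'] block_prodD[OF i(2), of j'] by auto
  qed
  moreover have "w \<in> P i j"
    using x(1) i(2) j by (simp add: block_prod_def)
  ultimately show "w \<in> (\<Union>i\<in>{i\<in>{1..n}. \<forall>j'\<in>{1..k} - {j}. block blk j' v \<in> P i j'}. P i j)"
    using i(1) by blast
next
  fix w assume "w \<in> (\<Union>i\<in>{i\<in>{1..n}. \<forall>j'\<in>{1..k} - {j}. block blk j' v \<in> P i j'}. P i j)"
  then obtain i where i: "i \<in> {1..n}" "\<forall>j'\<in>{1..k} - {j}. block blk j' v \<in> P i j'" "w \<in> P i j"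
    by blast
  have w: "block blk j w = w"
    using in_block_space[OF i(1) j] i(3) by (auto intro: block_of_block_space)
  let ?x = "replace_block blk j v w"
  have "?x \<in> block_prod blk k (P i)"
    using i w by (simp add: block_prod_def block_replace_block)
  then have "?x \<in> H" using i(1) by (auto simp: H_def region_def)
  moreover have "w = block blk j ?x" using w by (simp add: block_replace_block)
  ultimately show "w \<in> slice blk k H v j"
    unfolding slice_def
    by (intro CollectI exI[of _ ?x]) (simp add: block_replace_block)
qed

abbreviation slice_vert :: "real ^ 'n \<Rightarrow> nat \<Rightarrow> (real ^ 'n) set" where
  "slice_vert v j \<equiv> vert (convex hull (slice blk k H v j))"

text \<open>The convex hull of a slice is generated by the vertices of the finitely many polytopes that
  make up the slice.\<close>
lemma hull_slice:
  assumes j: "j \<in> {1..k}"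
  obtains A where "finite A" "A \<subseteq> (\<Union>i\<in>{1..n}. vert (P i j))"
    "convex hull (slice blk k H v j) = convex hull A"
proof
  let ?I = "{i\<in>{1..n}. \<forall>j'\<in>{1..k} - {j}. block blk j' v \<in> P i j'}"
  let ?A = "\<Union>i\<in>?I. vert (P i j)"
  show "finite ?A" using finite_vert j by auto
  show "?A \<subseteq> (\<Union>i\<in>{1..n}. vert (P i j))" by blast
  have "P i j \<subseteq> convex hull ?A" if "i \<in> ?I" for i
  proof -
    have "P i j = convex hull (vert (P i j))" using that j by (intro hull_vert) auto
    also have "\<dots> \<subseteq> convex hull ?A" using that by (intro hull_mono) blast
    finally show ?thesis .
  qed
  then have "convex hull (slice blk k H v j) \<subseteq> convex hull ?A"
    unfolding slice_eq[OF j] by (intro hull_minimal) auto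
  moreover have "convex hull ?A \<subseteq> convex hull (slice blk k H v j)"
    unfolding slice_eq[OF j] using vert_subset by (intro hull_mono) blast
  ultimately show "convex hull (slice blk k H v j) = convex hull ?A" by blast
qed

lemma slice_vert_subset_slice: "slice_vert v j \<subseteq> slice blk k H v j"
  using extreme_point_of_convex_hull by (auto simp: vert_def)

lemma slice_vert_subset_vert:
  assumes "j \<in> {1..k}"
  shows "slice_vert v j \<subseteq> (\<Union>i\<in>{1..n}. vert (P i j))"
proof -
  obtain A where "A \<subseteq> (\<Union>i\<in>{1..n}. vert (P i j))"
    "convex hull (slice blk k H v j) = convex hull A"
    using hull_slice[OF assms] by metis
  then show ?thesis
    using extreme_point_of_convex_hull by (fastforce simp: vert_def)
qed

lemma finite_slice_vert: "j \<in> {1..k} \<Longrightarrow> finite (slice_vert v j)"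
  using finite_subset[OF slice_vert_subset_vert] finite_vert by auto

lemma slice_representation:
  assumes j: "j \<in> {1..k}" and v: "v \<in> H"
  shows "\<exists>\<mu>. (\<forall>w\<in>slice_vert v j. 0 \<le> \<mu> w) \<and> (\<Sum>w\<in>slice_vert v j. \<mu> w) = 1 \<and>
    block blk j v = (\<Sum>w\<in>slice_vert v j. \<mu> w *\<^sub>R w)"
proof -
  obtain A where "finite A" "convex hull (slice blk k H v j) = convex hull A"
    using hull_slice[OF j] by metis
  then have "compact (convex hull (slice blk k H v j))"
    by (simp add: finite_imp_compact_convex_hull)
  then have "convex hull (slice blk k H v j) = convex hull (slice_vert v j)"
    unfolding vert_def by (intro Krein_Milman_Minkowski) auto
  then have "block blk j v \<in> convex hull (slice_vert v j)"
    using hull_inc[OF block_in_slice[OF v, of j], of convex] by simp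
  then show ?thesis
    unfolding convex_hull_finite[OF finite_slice_vert[OF j]] by fastforce
qed

text \<open>The definition of a corner point does not require \<open>v \<in> H\<close>; it follows because an extreme
  point of \<open>conv (S\<^sub>1 (v))\<close> lies in \<open>S\<^sub>1 (v)\<close> itself.\<close>
lemma corner_subset_H: "corner blk k H \<subseteq> H"
proof
  fix v assume "v \<in> corner blk k H"
  then have "block blk 1 v \<in> slice_vert v 1"
    using k_pos by (auto simp: corner_def extreme_block_def)
  then have "block blk 1 v \<in> slice blk k H v 1"
    using slice_vert_subset_slice by blast
  then show "v \<in> H" using replace_block_slice[of "block blk 1 v" v 1] by simp
qed

text \<open>A corner point is extreme in the larger set \<open>conv (S\<^sub>j (v))\<close>, hence in the polytope \<open>P\<^sub>i\<^sub>j\<close>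
  that contains its block.\<close>
lemma corner_subset_disc: "corner blk k H \<subseteq> disc blk k n P"
proof
  fix v assume v: "v \<in> corner blk k H"
  then obtain i where i: "i \<in> {1..n}" "v \<in> block_prod blk k (P i)"
    using corner_subset_H by (auto simp: H_def region_def)
  have "block blk j v \<in> vert (P i j)" if j: "j \<in> {1..k}" for j
  proof -
    have "P i j \<subseteq> slice blk k H v j"
      unfolding slice_eq[OF j] using i(1) block_prodD[OF i(2)] by blast
    then have "P i j \<subseteq> convex hull (slice blk k H v j)"
      by (rule order_trans[OF _ hull_subset])
    moreover have "block blk j v \<in> slice_vert v j"
      using v j by (auto simp: corner_def extreme_block_def)
    ultimately show ?thesis
      using block_prodD[OF i(2) j] unfolding vert_def extreme_point_of_def by blast
  qed
  then show "v \<in> disc blk k n P"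
    using i(1) unfolding disc_def block_prod_def by blast
qed

section \<open>Runs of the algorithm\<close>

text \<open>The row of a processed point \<open>v\<close>: transition probabilities into \<open>X\<close> that reproduce the value
  at \<open>v\<close> of every multilinear function, and that fix \<open>v\<close> exactly if \<open>v\<close> is a corner point.\<close>
definition proper_row :: "(real ^ 'n) set \<Rightarrow> (real ^ 'n \<Rightarrow> real ^ 'n \<Rightarrow> real) \<Rightarrow> real ^ 'n \<Rightarrow> bool" where
  "proper_row X T v \<longleftrightarrow> (\<forall>b. 0 \<le> T v b) \<and> (\<forall>b. b \<notin> X \<longrightarrow> T v b = 0) \<and>
     (T v v = 1 \<longleftrightarrow> v \<in> corner blk k H) \<and>
     (\<forall>M. multilinear blk k M \<longrightarrow> (\<Sum>b\<in>X. T v b * M b) = M v)"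

text \<open>The states that have left the stack; this set grows strictly in every iteration.\<close>
definition processed :: "'n mc_state \<Rightarrow> (real ^ 'n) set" where
  "processed = (\<lambda>(X, U, T). X - set U)"

text \<open>The invariant of the loop. Rows of points that are not yet processed are \<open>0\<close>, so the entries
  written for a popped point make up its whole row.\<close>
definition valid_state :: "'n mc_state \<Rightarrow> bool" where
  "valid_state = (\<lambda>(X, U, T). disc blk k n P \<subseteq> X \<and> X \<subseteq> grid \<inter> H \<and> distinct U \<and> set U \<subseteq> X \<and>
     (\<forall>v. v \<notin> X - set U \<longrightarrow> (\<forall>b. T v b = 0)) \<and> (\<forall>v\<in>X - set U. proper_row X T v))"

text \<open>Later iterations add states but leave the rows of processed points unchanged.\<close>
lemma proper_row_mono:
  assumes row: "proper_row X T v" and X: "X \<subseteq> X'" "finite X'" and T: "T' v = T v"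
  shows "proper_row X' T' v"
proof -
  have "(\<Sum>b\<in>X'. T v b * M b) = (\<Sum>b\<in>X. T v b * M b)" for M
    using row X by (intro sum.mono_neutral_right) (auto simp: proper_row_def)
  then show ?thesis using row X(1) T by (auto simp: proper_row_def)
qed

lemma valid_state_init:
  assumes "mc_init blk k n P s"
  shows "valid_state s"
  using assms disc_subset_grid disc_subset_H by (auto simp: mc_init_def valid_state_def)

text \<open>The row written by an iteration that moves along block \<open>j\<close>. It gives weight \<open>0\<close> to \<open>v\<close>
  itself, because block \<open>j\<close> of every point in \<open>N\<close> is an extreme point of
  \<open>conv (S\<^sub>j (v))\<close>, whereas block \<open>j\<close> of \<open>v\<close> is not.\<close>
lemma move_row:
  assumes j: "j \<in> {1..k}" and ne: "\<not> extreme_block blk k H v j"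
    and \<mu>: "\<forall>w\<in>slice_vert v j. 0 \<le> \<mu> w" "(\<Sum>w\<in>slice_vert v j. \<mu> w) = 1"
      "block blk j v = (\<Sum>w\<in>slice_vert v j. \<mu> w *\<^sub>R w)"
    and N: "N = replace_block blk j v ` {w \<in> slice_vert v j. 0 < \<mu> w}"
    and X: "N \<subseteq> X" "finite X"
    and T: "\<And>b. T v b = (if b \<in> N then \<mu> (block blk j b) else 0)"
  shows "proper_row X T v"
proof -
  let ?W = "slice_vert v j"
  have W: "?W \<subseteq> block_space blk j"
    using slice_vert_subset_slice slice_subset_block_space by blast
  have blkW: "block blk j (replace_block blk j v w) = w" if "w \<in> ?W" for w
    using W that by (auto simp: block_replace_block block_of_block_space)
  have "block blk j b \<in> ?W" if "b \<in> N" for b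
    using that blkW unfolding N by auto
  then have "v \<notin> N"
    using ne by (auto simp: extreme_block_def)
  moreover have "v \<notin> corner blk k H"
    using j ne by (auto simp: corner_def)
  moreover have "0 \<le> T v b" for b
    using T N \<mu>(1) blkW by auto
  moreover have "(\<Sum>b\<in>X. T v b * M b) = M v" if M: "multilinear blk k M" for M
  proof -
    have inj: "inj_on (replace_block blk j v) {w \<in> ?W. 0 < \<mu> w}"
      by (rule inj_on_inverseI[of _ "block blk j"]) (use blkW in auto)
    have "(\<Sum>b\<in>X. T v b * M b) = (\<Sum>b\<in>N. \<mu> (block blk j b) * M b)"
      using X T by (intro sum.mono_neutral_cong_right) auto
    also have "\<dots> = (\<Sum>w\<in>{w \<in> ?W. 0 < \<mu> w}. \<mu> w * M (replace_block blk j v w))"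
      unfolding N sum.reindex[OF inj] using blkW by (auto intro!: sum.cong)
    also have "\<dots> = (\<Sum>w\<in>?W. \<mu> w * M (replace_block blk j v w))"
      using \<mu>(1) finite_slice_vert[OF j] by (intro sum.mono_neutral_left) force+
    also have "\<dots> = M v"
      using multilinear_block_combination[OF M j W \<mu>(2,3)] by simp
    finally show ?thesis .
  qed
  ultimately show ?thesis
    using T X(1) by (auto simp: proper_row_def)
qed

lemma valid_state_step:
  assumes step: "mc_step blk k H s s'" and valid: "valid_state s"
  shows "valid_state s' \<and> processed s \<subset> processed s'"
  using step
proof cases
  case (stay v X U T)
  let ?T = "\<lambda>a b. if a = v \<and> b = v then 1 else T a b"
  have v: "v \<in> corner blk k H"
    using stay by (simp add: corner_def)
  have inv: "disc blk k n P \<subseteq> X" "X \<subseteq> grid \<inter> H" "v \<notin> set U" "distinct U" "set U \<subseteq> X" "v \<in> X"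
    "\<And>a b. a \<notin> X - set (v # U) \<Longrightarrow> T a b = 0"
    "\<And>a. a \<in> X - set (v # U) \<Longrightarrow> proper_row X T a"
    using valid stay(1) by (auto simp: valid_state_def)
  have X: "finite X"
    using inv(2) finite_grid by (meson finite_subset le_infE)
  have Tv: "?T v b = (if b = v then 1 else 0)" for b
    using inv(7) by auto
  have "(\<Sum>b\<in>X. ?T v b * M b) = M v" for M
  proof -
    have "(\<Sum>b\<in>X. ?T v b * M b) = (\<Sum>b\<in>X. if b = v then M b else 0)"
      unfolding Tv by (intro sum.cong) auto
    then show ?thesis using X inv(6) by simp
  qed
  then have "proper_row X ?T v"
    using v inv(6) Tv unfolding proper_row_def by auto
  moreover have "proper_row X ?T a" if a: "a \<in> X - set U" "a \<noteq> v" for a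
  proof (rule proper_row_mono)
    show "proper_row X T a" using inv(8) a by simp
  qed (use a X in auto)
  ultimately have "\<forall>a\<in>X - set U. proper_row X ?T a" by blast
  moreover have "\<forall>a. a \<notin> X - set U \<longrightarrow> (\<forall>b. ?T a b = 0)"
    using inv(3,6,7) by auto
  ultimately have "valid_state s'"
    unfolding stay(2) valid_state_def prod.case using inv(1,2,4,5) by blast
  moreover have "processed s \<subset> processed s'"
    unfolding stay(1,2) processed_def prod.case using inv(3,6) by auto
  ultimately show ?thesis by blast
next
  case (move j v W \<mu> N us X U T)
  let ?X = "X \<union> set us"
  let ?T = "\<lambda>a b. if a = v \<and> b \<in> N then \<mu> (block blk j b) else T a b"
  have inv: "disc blk k n P \<subseteq> X" "X \<subseteq> grid \<inter> H" "v \<notin> set U" "distinct U" "set U \<subseteq> X" "v \<in> X"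
    "\<And>a b. a \<notin> X - set (v # U) \<Longrightarrow> T a b = 0"
    "\<And>a. a \<in> X - set (v # U) \<Longrightarrow> proper_row X T a"
    using valid move(1) by (auto simp: valid_state_def)
  have j: "j \<in> {1..k}" by fact
  have us: "set us = N - X" "distinct us"
    using move inv(5) by auto
  have NGH: "N \<subseteq> grid \<inter> H"
  proof
    fix u assume "u \<in> N"
    then obtain w where w: "w \<in> slice_vert v j" "u = replace_block blk j v w"
      using move by auto
    have wS: "w \<in> slice blk k H v j" using w(1) slice_vert_subset_slice by blast
    have "block blk j w = w"
      using wS slice_subset_block_space by (auto intro: block_of_block_space)
    moreover have "w \<in> (\<Union>i\<in>{1..n}. vert (P i j))"
      using w(1) slice_vert_subset_vert[OF j] by blast
    moreover have "v \<in> grid" using inv by blast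
    ultimately have "u \<in> grid"
      using w(2) by (simp add: grid_def block_prod_def block_replace_block)
    then show "u \<in> grid \<inter> H" using replace_block_slice[OF wS] w(2) by blast
  qed
  have XGH: "?X \<subseteq> grid \<inter> H" using inv(2) NGH us by blast
  then have X: "finite ?X"
    using finite_grid by (meson finite_subset le_infE)
  have "proper_row ?X ?T v"
  proof (rule move_row[OF j])
    show "N \<subseteq> ?X" using us by blast
    show "?T v b = (if b \<in> N then \<mu> (block blk j b) else 0)" for b
      using inv(7) by auto
  qed (use move X in auto)
  moreover have "proper_row ?X ?T a" if a: "a \<in> X - set (v # U)" for a
    by (rule proper_row_mono[OF inv(8)[OF a]]) (use a X in auto)
  moreover have proc: "?X - set (us @ U) = insert v (X - set (v # U))"
    using inv(3,6) us by auto
  ultimately have rows: "\<forall>a\<in>?X - set (us @ U). proper_row ?X ?T a" by auto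
  have zero: "\<forall>a. a \<notin> ?X - set (us @ U) \<longrightarrow> (\<forall>b. ?T a b = 0)"
    unfolding proc using inv(7) by auto
  have "valid_state s'"
    unfolding move(2) valid_state_def prod.case using rows zero XGH inv(1,4,5) us by auto
  moreover have "processed s \<subset> processed s'"
    unfolding move(1,2) processed_def prod.case proc by auto
  ultimately show ?thesis by blast
qed

lemma valid_state_reachable:
  assumes "mc_reachable blk k n P s"
  shows "valid_state s"
proof -
  obtain s0 where "mc_init blk k n P s0" "(mc_step blk k H)\<^sup>*\<^sup>* s0 s"
    using assms by (auto simp: mc_reachable_def H_def)
  from this(2,1) show ?thesis
    by (induction rule: rtranclp_induct) (auto simp: valid_state_init valid_state_step)
qed

text \<open>The loop never gets stuck: the required convex representation exists since the hull of a
  slice is compact and therefore spanned by its extreme points.\<close>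
lemma step_exists:
  assumes "valid_state (X, v # U, T)"
  shows "\<exists>s. mc_step blk k H (X, v # U, T) s"
proof (cases "\<forall>j\<in>{1..k}. extreme_block blk k H v j")
  case True
  then show ?thesis by (blast intro: mc_step.stay)
next
  case False
  let ?bad = "\<lambda>j. j \<in> {1..k} \<and> \<not> extreme_block blk k H v j"
  define j where "j = (LEAST j. ?bad j)"
  have j: "j \<in> {1..k}" "\<not> extreme_block blk k H v j"
    using LeastI_ex[of ?bad] False unfolding j_def by blast+
  have less: "\<forall>j'\<in>{1..<j}. extreme_block blk k H v j'"
  proof
    fix j' assume j': "j' \<in> {1..<j}"
    then have "\<not> ?bad j'" unfolding j_def using not_less_Least[of j' ?bad] by simp
    then show "extreme_block blk k H v j'" using j' j(1) by auto
  qed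
  have "v \<in> H" using assms by (auto simp: valid_state_def)
  then obtain \<mu> where \<mu>: "\<forall>w\<in>slice_vert v j. 0 \<le> \<mu> w" "(\<Sum>w\<in>slice_vert v j. \<mu> w) = 1"
    "block blk j v = (\<Sum>w\<in>slice_vert v j. \<mu> w *\<^sub>R w)"
    using slice_representation[OF j(1)] by blast
  let ?N = "replace_block blk j v ` {w \<in> slice_vert v j. 0 < \<mu> w}"
  have "finite (?N - (X \<union> set U))" using finite_slice_vert[OF j(1)] by simp
  then obtain us where "distinct us" "set us = ?N - (X \<union> set U)"
    using finite_distinct_list by blast
  then show ?thesis
    using mc_step.move[OF j less refl \<mu> refl] by blast
qed

lemma no_infinite_run:
  "\<not> (mc_init blk k n P (\<sigma> 0) \<and> (\<forall>t. mc_step blk k H (\<sigma> t) (\<sigma> (Suc t))))"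
proof
  assume run: "mc_init blk k n P (\<sigma> 0) \<and> (\<forall>t. mc_step blk k H (\<sigma> t) (\<sigma> (Suc t)))"
  have valid: "valid_state (\<sigma> t)" for t
    using run by (induction t) (auto intro: valid_state_init dest: valid_state_step)
  have sub: "processed (\<sigma> t) \<subseteq> grid" for t
    using valid[of t] by (auto simp: valid_state_def processed_def)
  have "t \<le> card (processed (\<sigma> t))" for t
  proof (induction t)
    case (Suc t)
    have "processed (\<sigma> t) \<subset> processed (\<sigma> (Suc t))"
      using run valid valid_state_step by blast
    then have "card (processed (\<sigma> t)) < card (processed (\<sigma> (Suc t)))"
      using finite_subset[OF sub finite_grid] by (intro psubset_card_mono)
    then show ?case using Suc by simp
  qed simp
  moreover have "card (processed (\<sigma> t)) \<le> card grid" for t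
    using sub finite_grid by (intro card_mono)
  ultimately show False
    by (meson Suc_n_not_le_n order_trans)
qed

lemma terminates: "mc_terminates blk k n P"
proof -
  have "finite (disc blk k n P)"
    using disc_subset_grid finite_grid by (rule finite_subset)
  then have "\<exists>s. mc_init blk k n P s"
    unfolding mc_init_def using finite_distinct_list by blast
  moreover have "\<exists>s. mc_step blk k H (X, U, T) s"
    if "mc_reachable blk k n P (X, U, T)" "U \<noteq> []" for X U T
    using valid_state_reachable[OF that(1)] that(2) step_exists by (cases U) auto
  ultimately show ?thesis
    using no_infinite_run unfolding mc_terminates_def H_def by blast
qed

section \<open>The returned chain\<close>

context
  fixes X T
  assumes nonempty: "H \<noteq> {}" and returns: "mc_returns blk k n P X T"
begin

lemma returned_states: "disc blk k n P \<subseteq> X" "X \<subseteq> H" "finite X"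
  and returned_rows: "\<And>v. v \<in> X \<Longrightarrow> proper_row X T v"
  using valid_state_reachable[of "(X, [], T)"] returns finite_subset[OF _ finite_grid]
  by (auto simp: mc_returns_def valid_state_def)

lemma returned_multilinear:
  "\<lbrakk>v \<in> X; multilinear blk k M\<rbrakk> \<Longrightarrow> (\<Sum>b\<in>X. T v b * M b) = M v"
  using returned_rows by (auto simp: proper_row_def)

lemma returned_markov: "finite_markov_chain X T"
proof -
  have "(\<Sum>b\<in>X. T v b) = 1" if "v \<in> X" for v
    using returned_multilinear[OF that multilinear_const[of _ _ 1]] by simp
  moreover have "X \<noteq> {}"
    using disc_nonempty[OF nonempty] returned_states by blast
  ultimately show ?thesis
    using returned_states returned_rows by (auto simp: finite_markov_chain_def proper_row_def)
qed

lemma returned_barycentric: "\<forall>v\<in>X. (\<Sum>b\<in>X. T v b *\<^sub>R b) = v"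
  using returned_multilinear[OF _ multilinear_nth] by (auto simp: vec_eq_iff)

lemma returned_absorbing_states: "absorbing_states X T = corner blk k H"
  using returned_rows corner_subset_disc returned_states
  by (auto simp: absorbing_states_def proper_row_def)

lemma returned_values:
  assumes "x \<in> X" "multilinear blk k M"
  shows "M x = (\<Sum>v\<in>corner blk k H. trans_lim X T x v * M v)"
  using barycentric_chain_harmonic[OF returned_markov returned_barycentric _ assms(1), of M]
    returned_multilinear assms(2) by (simp add: returned_absorbing_states)

lemma returned_graph:
  assumes "x \<in> X" "multilinear_on blk k H M"
  shows "(x, M x) = (\<Sum>v\<in>corner blk k H. trans_lim X T x v *\<^sub>R (v, M v))"
proof -
  obtain M' where M': "multilinear blk k M'" "\<And>x. x \<in> H \<Longrightarrow> M x = M' x"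
    using assms(2) by (auto simp: multilinear_on_def)
  have "(x, M x) = (x, M' x)"
    using assms(1) returned_states M'(2) by auto
  also have "\<dots> = (\<Sum>v\<in>corner blk k H. trans_lim X T x v *\<^sub>R (v, M' v))"
    by (rule graph_combination[OF M'(1) returned_values[OF assms(1)]])
  also have "\<dots> = (\<Sum>v\<in>corner blk k H. trans_lim X T x v *\<^sub>R (v, M v))"
    using corner_subset_H M'(2) by (intro sum.cong) auto
  finally show ?thesis .
qed

lemma returned_graph_piece:
  assumes i: "i \<in> {1..n}" and x: "x \<in> block_prod blk k (P i)"
    and l: "\<And>j. j \<in> {1..k} \<Longrightarrow> (\<Sum>w\<in>vert (P i j). l j w) = 1"
      "\<And>j. j \<in> {1..k} \<Longrightarrow> block blk j x = (\<Sum>w\<in>vert (P i j). l j w *\<^sub>R w)"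
    and M: "multilinear_on blk k H M"
  shows "(x, M x) = (\<Sum>v'\<in>vert (block_prod blk k (P i)). \<Sum>v\<in>corner blk k H.
    ((\<Prod>j=1..k. l j (block blk j v')) * trans_lim X T v' v) *\<^sub>R (v, M v))"
proof -
  let ?V = "vert (block_prod blk k (P i))" and ?p = "\<lambda>v'. \<Prod>j=1..k. l j (block blk j v')"
  obtain M' where M': "multilinear blk k M'" "\<And>x. x \<in> H \<Longrightarrow> M x = M' x"
    using M by (auto simp: multilinear_on_def)
  have vert_eq: "?V = block_prod blk k (\<lambda>j. vert (P i j))"
    using in_block_space[OF i] by (rule vert_block_prod[OF blk])
  have VX: "?V \<subseteq> X"
    using vert_piece_subset_disc[OF i] returned_states by blast
  have V: "vert (P i j) \<subseteq> block_space blk j" if "j \<in> {1..k}" for j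
    using in_block_space[OF i that] vert_subset by blast
  have "x \<in> H" using i x by (auto simp: H_def region_def)
  then have "(x, M x) = (x, M' x)" using M'(2) by simp
  also have "\<dots> = (\<Sum>v'\<in>?V. ?p v' *\<^sub>R (v', M' v'))"
    unfolding vert_eq
    by (rule graph_combination[OF M'(1)]) (rule multilinear_expansion[OF blk _ V l])
  also have "\<dots> = (\<Sum>v'\<in>?V. ?p v' *\<^sub>R (\<Sum>v\<in>corner blk k H. trans_lim X T v' v *\<^sub>R (v, M v)))"
  proof (rule sum.cong[OF refl])
    fix v' assume "v' \<in> ?V"
    then have "v' \<in> X" using VX by blast
    moreover from this have "M v' = M' v'" using returned_states by (intro M'(2)) blast
    ultimately show "?p v' *\<^sub>R (v', M' v')
        = ?p v' *\<^sub>R (\<Sum>v\<in>corner blk k H. trans_lim X T v' v *\<^sub>R (v, M v))"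
      using returned_graph[OF _ M, of v'] by (simp only:)
  qed
  finally show ?thesis
    by (simp only: scaleR_sum_right scaleR_scaleR)
qed

end

end

theorem theorem6:
  fixes blk :: "'n::finite \<Rightarrow> nat" and k n :: nat
    and P :: "nat \<Rightarrow> nat \<Rightarrow> (real ^ 'n) set" and H :: "(real ^ 'n) set"
  assumes "\<forall>c. blk c \<in> {1..k}"
    and "\<forall>i\<in>{1..n}. \<forall>j\<in>{1..k}. polytope (P i j) \<and> P i j \<subseteq> block_space blk j"
    and "H = region blk k n P" and "H \<noteq> {}"
  shows "mc_terminates blk k n P \<and>
    (\<forall>X T. mc_returns blk k n P X T \<longrightarrow>
       absorbing_chain X T \<and>
       absorbing_states X T = corner blk k H \<and>
       (\<forall>x\<in>X. \<forall>y\<in>X. (\<lambda>t. trans_pow X T t x y) \<longlonglongrightarrow> trans_lim X T x y) \<and>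
       (\<forall>M. multilinear_on blk k H M \<longrightarrow>
          (\<forall>x\<in>X. (x, M x) = (\<Sum>v\<in>corner blk k H. trans_lim X T x v *\<^sub>R (v, M v))) \<and>
          (\<forall>i\<in>{1..n}. \<forall>x\<in>block_prod blk k (P i). \<forall>l :: nat \<Rightarrow> real ^ 'n \<Rightarrow> real.
             (\<forall>j\<in>{1..k}. (\<forall>w\<in>vert (P i j). 0 \<le> l j w) \<and> (\<Sum>w\<in>vert (P i j). l j w) = 1 \<and>
                block blk j x = (\<Sum>w\<in>vert (P i j). l j w *\<^sub>R w)) \<longrightarrow>
             (x, M x) =
               (\<Sum>v'\<in>vert (block_prod blk k (P i)). \<Sum>v\<in>corner blk k H.
                  ((\<Prod>j=1..k. l j (block blk j v')) * trans_lim X T v' v) *\<^sub>R (v, M v)))))"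
proof -
  interpret axis_aligned blk k n P
    using assms(1,2) by unfold_locales auto
  have H: "local.H = H" using assms(3) by (simp add: H_def)
  show ?thesis
    unfolding H[symmetric]
  proof (intro conjI allI impI ballI)
    show "mc_terminates blk k n P" by (rule terminates)
  next
    fix X T assume "mc_returns blk k n P X T"
    note * = assms(4)[folded H] this
    show "absorbing_chain X T"
      by (rule barycentric_chain_absorbing[OF returned_markov[OF *] returned_barycentric[OF *]])
    show "absorbing_states X T = corner blk k local.H"
      by (rule returned_absorbing_states[OF *])
    show "(\<lambda>t. trans_pow X T t x y) \<longlonglongrightarrow> trans_lim X T x y" if "x \<in> X" "y \<in> X" for x y
      using barycentric_chain_tendsto[OF returned_markov[OF *] returned_barycentric[OF *]] that .
    fix M assume M: "multilinear_on blk k local.H M"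
    show "(x, M x) = (\<Sum>v\<in>corner blk k local.H. trans_lim X T x v *\<^sub>R (v, M v))" if "x \<in> X" for x
      using returned_graph[OF * that M] .
    fix i x and l :: "nat \<Rightarrow> real ^ 'n \<Rightarrow> real"
    assume "i \<in> {1..n}" "x \<in> block_prod blk k (P i)"
      "\<forall>j\<in>{1..k}. (\<forall>w\<in>vert (P i j). 0 \<le> l j w) \<and> (\<Sum>w\<in>vert (P i j). l j w) = 1 \<and>
         block blk j x = (\<Sum>w\<in>vert (P i j). l j w *\<^sub>R w)"
    then show "(x, M x) = (\<Sum>v'\<in>vert (block_prod blk k (P i)). \<Sum>v\<in>corner blk k local.H.
        ((\<Prod>j=1..k. l j (block blk j v')) * trans_lim X T v' v) *\<^sub>R (v, M v))"
      by (intro returned_graph_piece[OF * _ _ _ _ M]) auto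
  qed
qed

end
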